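(* Consider a John elastic material with rigidity parameter $k>0$ whose underlying fluid has the linear equation of state $p_0=(\Gamma-1)\rho_0$ with $1<\Gamma\le 2$, i.e. $\hat\rho_0(n)=a n^\Gamma$ and $\hat p_0(n)=a(\Gamma-1)n^\Gamma$ for some constant $a>0$. Let $(x,y,m)$ be a regular ball solution with radius $R>0$ and let $\rho(r)=\hat\rho(x(r),y(r))$, $p_{\mathrm{rad}}(r)=\hat p_{\mathrm{rad}}(x(r),y(r))$, $p_{\mathrm{tan}}(r)=\hat p_{\mathrm{tan}}(x(r),y(r))$. Then: \begin{itemize} \item[(i)] If $k<1$ and $1<\Gamma\le 2-\max(k,1/3)$, the elastic body satisfies the dominant energy condition. \item[(ii)] If $\Gamma>5/3$, the dominant energy condition in the tangential direction is violated in an interior neighborhood of the boundary, i.e., there exists $\varepsilon>0$ such that $p_{\mathrm{tan}}(r)>\rho(r)$ for $r\in(R-\varepsilon,R]$. \end{itemize}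
   Context: John elastic material. Given $k\ge 0$ (the rigidity parameter) and a function $\hat\rho_0$ of $n\ge 0$, let $\hat p_0(n)=n^2\frac{d}{dn}\big(\hat\rho_0(n)/n\big)$; the pair $(\hat\rho_0,\hat p_0)$ is called the underlying fluid. With $n=y\sqrt{x}$ and $x,y\geq 0$, set $$\hat\rho(x,y)=\hat\rho_0(n)\Big[1+k\Big(\frac{x+2y}{n^{2/3}}-3\Big)\Big],$$ $$\hat p_{\mathrm{rad}}(x,y)=\hat p_0(n)\Big[1+k\Big(\frac{x+2y}{n^{2/3}}-3\Big)\Big]+\hat\rho_0(n)\frac{4k(x-y)}{3n^{2/3}},$$ $$\hat p_{\mathrm{tan}}(x,y)=\hat p_0(n)\Big[1+k\Big(\frac{x+2y}{n^{2/3}}-3\Big)\Big]-\hat\rho_0(n)\frac{2k(x-y)}{3n^{2/3}},$$ these functions being equal to $0$ when $x=0$ or $y=0$. The dominant energy condition in the radial (resp. tangential) direction is the inequality $|p_{\mathrm{rad}}(r)|\le\rho(r)$ (resp. $|p_{\mathrm{tan}}(r)|\le\rho(r)$) in the body; the dominant energy condition is satisfied if it is satisfied in both directions. The system. For radial functions $x(r),y(r),m(r)$ (prime denotes $d/dr$; $\hat\rho,\hat p_{\mathrm{rad}},\hat p_{\mathrm{tan}}$ and their partial derivatives are evaluated at $(x(r),y(r))$): $$x'=\frac{1}{\partial_x\hat p_{\mathrm{rad}}}\Big[-(\hat p_{\mathrm{rad}}+\hat\rho)\frac{m+r^3\hat p_{\mathrm{rad}}/2}{r(r-2m)}+\frac{2}{r}(\hat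 p_{\mathrm{tan}}-\hat p_{\mathrm{rad}})-y'\,\partial_y\hat p_{\mathrm{rad}}\Big],$$ $$y'=\frac{2}{r}\Big(\sqrt{\frac{r}{r-2m}\,xy}-y\Big),\qquad m'=\frac12 r^2\hat\rho.$$ Regular ball solution. A triple $(x,y,m)$ of radial functions is called a regular ball solution of this system with radius $R>0$ and ADM mass $M>0$ if: (i) $x,y,m\in C^1([0,R])$ (meaning $C^1$ on $(0,R)$, with the functions and their derivatives extending continuously to the boundary); (ii) $x(0)=y(0)=:h>0$ and $m(0)=0$; (iii) $x,y>0$ for $r\in[0,R)$, and $0<2m(r)<r$ for all $r>0$; (iv) for $r>R$, $x=y=0$ and $m=m(R)=:M$; (v) $p_{\mathrm{rad}}(r):=\hat p_{\mathrm{rad}}(x(r),y(r))$ satisfies $p_{\mathrm{rad}}(r)>0$ for $r\in[0,R)$ and $p_{\mathrm{rad}}(R)=0$; (vi) $(x,y,m)$ solves the system for $r\in(0,R)$. *)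

theory Defs
  imports "HOL-Analysis.Analysis"
begin

section \<open>John elastic materials\<close>

definition fluid_pressure :: "(real \<Rightarrow> real) \<Rightarrow> real \<Rightarrow> real" where
  "fluid_pressure \<rho>0 n = n\<^sup>2 * deriv (\<lambda>t. \<rho>0 t / t) n"

definition particle_density :: "real \<Rightarrow> real \<Rightarrow> real" where
  "particle_density x y = y * sqrt x"

definition shear_factor :: "real \<Rightarrow> real \<Rightarrow> real \<Rightarrow> real" where
  "shear_factor k x y = 1 + k * ((x + 2 * y) / particle_density x y powr (2/3) - 3)"

text \<open>The constitutive functions are only meaningful on the quadrant \<open>x, y \<ge> 0\<close>;
  \<open>\<rho>0\<close> is the energy density of the underlying fluid and \<open>k\<close> the rigidity parameter.\<close>

definition rho_hat :: "(real \<Rightarrow> real) \<Rightarrow> real \<Rightarrow> real \<Rightarrow> real \<Rightarrow> real" where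
  "rho_hat \<rho>0 k x y =
     (if x = 0 \<or> y = 0 then 0
      else \<rho>0 (particle_density x y) * shear_factor k x y)"

definition prad_hat :: "(real \<Rightarrow> real) \<Rightarrow> real \<Rightarrow> real \<Rightarrow> real \<Rightarrow> real" where
  "prad_hat \<rho>0 k x y =
     (if x = 0 \<or> y = 0 then 0
      else fluid_pressure \<rho>0 (particle_density x y) * shear_factor k x y
         + \<rho>0 (particle_density x y) *
             (4 * k * (x - y) / (3 * particle_density x y powr (2/3))))"

definition ptan_hat :: "(real \<Rightarrow> real) \<Rightarrow> real \<Rightarrow> real \<Rightarrow> real \<Rightarrow> real" where
  "ptan_hat \<rho>0 k x y =
     (if x = 0 \<or> y = 0 then 0
      else fluid_pressure \<rho>0 (particle_density x y) * shear_factor k x y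
         - \<rho>0 (particle_density x y) *
             (2 * k * (x - y) / (3 * particle_density x y powr (2/3))))"

definition prad_hat_dx :: "(real \<Rightarrow> real) \<Rightarrow> real \<Rightarrow> real \<Rightarrow> real \<Rightarrow> real" where
  "prad_hat_dx \<rho>0 k x y = deriv (\<lambda>s. prad_hat \<rho>0 k s y) x"

definition prad_hat_dy :: "(real \<Rightarrow> real) \<Rightarrow> real \<Rightarrow> real \<Rightarrow> real \<Rightarrow> real" where
  "prad_hat_dy \<rho>0 k x y = deriv (\<lambda>s. prad_hat \<rho>0 k x s) y"

text \<open>The linear equation of state: the power law \<open>\<rho>0 n = a n\<^sup>\<Gamma>\<close> yields \<open>p0 = (\<Gamma> - 1) \<rho>0\<close>.\<close>

lemma fluid_pressure_power_law:
  assumes "\<And>n. n \<ge> 0 \<Longrightarrow> \<rho>0 n = a * n powr \<Gamma>" and "n \<ge> 0"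
  shows "fluid_pressure \<rho>0 n = a * (\<Gamma> - 1) * n powr \<Gamma>"
proof (cases "n = 0")
  case False
  with assms have n: "n > 0" by simp
  have "((\<lambda>t. a * t powr (\<Gamma> - 1)) has_real_derivative a * ((\<Gamma> - 1) * n powr (\<Gamma> - 1 - 1))) (at n)"
    using n by (intro DERIV_cmult has_real_derivative_powr)
  moreover have "\<rho>0 t / t = a * t powr (\<Gamma> - 1)" if "t \<in> {0<..}" for t
    using that assms(1)[of t] by (simp add: powr_diff)
  ultimately have "((\<lambda>t. \<rho>0 t / t) has_real_derivative a * ((\<Gamma> - 1) * n powr (\<Gamma> - 1 - 1))) (at n)"
    using n by (auto intro: has_field_derivative_transform_within_open[where S = "{0<..}"])
  then have "deriv (\<lambda>t. \<rho>0 t / t) n = a * ((\<Gamma> - 1) * n powr (\<Gamma> - 1 - 1))"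
    by (rule DERIV_imp_deriv)
  then show ?thesis
    using n by (simp add: fluid_pressure_def powr_diff power2_eq_square)
qed (simp add: fluid_pressure_def)

section \<open>Regular ball solutions\<close>

text \<open>The coefficient \<open>1 / \<partial>\<^sub>x p\<^sub>r\<^sub>a\<^sub>d\<close> has to make sense along a solution. Since division by zero is
  total in HOL, the non-vanishing of \<open>\<partial>\<^sub>x p\<^sub>r\<^sub>a\<^sub>d\<close> is stated explicitly.\<close>

definition solves_john_system ::
  "(real \<Rightarrow> real) \<Rightarrow> real \<Rightarrow> real \<Rightarrow> (real \<Rightarrow> real) \<Rightarrow> (real \<Rightarrow> real) \<Rightarrow> (real \<Rightarrow> real) \<Rightarrow> bool" where
  "solves_john_system \<rho>0 k R x y m \<longleftrightarrow>
     (\<forall>r\<in>{0<..<R}.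
        let \<rho> = rho_hat \<rho>0 k (x r) (y r);
            pr = prad_hat \<rho>0 k (x r) (y r);
            pt = ptan_hat \<rho>0 k (x r) (y r);
            pr_x = prad_hat_dx \<rho>0 k (x r) (y r);
            pr_y = prad_hat_dy \<rho>0 k (x r) (y r)
        in pr_x \<noteq> 0
         \<and> (x has_real_derivative
              1 / pr_x *
                (- (pr + \<rho>) * ((m r + r^3 * pr / 2) / (r * (r - 2 * m r)))
                 + 2 / r * (pt - pr) - deriv y r * pr_y)) (at r)
         \<and> (y has_real_derivative
              2 / r * (sqrt (r / (r - 2 * m r) * (x r * y r)) - y r)) (at r)
         \<and> (m has_real_derivative 1 / 2 * r\<^sup>2 * \<rho>) (at r))"

text \<open>\<open>C\<^sup>1([0,R])\<close>: differentiable on the open interval, the function and its derivative extending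
  continuously to the end points. The value at an end point is that of the extension, so a
  jump at \<open>R\<close> from the right is allowed.\<close>

definition C1_upto_boundary :: "real \<Rightarrow> (real \<Rightarrow> real) \<Rightarrow> bool" where
  "C1_upto_boundary R f \<longleftrightarrow>
     continuous_on {0..R} f \<and>
     (\<exists>f'. continuous_on {0..R} f' \<and> (\<forall>r\<in>{0<..<R}. (f has_real_derivative f' r) (at r)))"

definition regular_ball_solution ::
  "(real \<Rightarrow> real) \<Rightarrow> real \<Rightarrow> real \<Rightarrow> real \<Rightarrow> (real \<Rightarrow> real) \<Rightarrow> (real \<Rightarrow> real) \<Rightarrow> (real \<Rightarrow> real) \<Rightarrow> bool"
where
  "regular_ball_solution \<rho>0 k R M x y m \<longleftrightarrow>
     R > 0 \<and> M > 0 \<and>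
     C1_upto_boundary R x \<and> C1_upto_boundary R y \<and> C1_upto_boundary R m \<and>
     x 0 = y 0 \<and> x 0 > 0 \<and> m 0 = 0 \<and>
     (\<forall>r\<in>{0..<R}. x r > 0 \<and> y r > 0) \<and>
     (\<forall>r>0. 0 < 2 * m r \<and> 2 * m r < r) \<and>
     (\<forall>r>R. x r = 0 \<and> y r = 0 \<and> m r = m R) \<and> m R = M \<and>
     (\<forall>r\<in>{0..<R}. prad_hat \<rho>0 k (x r) (y r) > 0) \<and> prad_hat \<rho>0 k (x R) (y R) = 0 \<and>
     solves_john_system \<rho>0 k R x y m"

section \<open>Dominant energy condition\<close>

definition dominant_energy_rad ::
  "(real \<Rightarrow> real) \<Rightarrow> real \<Rightarrow> real \<Rightarrow> (real \<Rightarrow> real) \<Rightarrow> (real \<Rightarrow> real) \<Rightarrow> bool" where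
  "dominant_energy_rad \<rho>0 k R x y \<longleftrightarrow>
     (\<forall>r\<in>{0..R}. \<bar>prad_hat \<rho>0 k (x r) (y r)\<bar> \<le> rho_hat \<rho>0 k (x r) (y r))"

definition dominant_energy_tan ::
  "(real \<Rightarrow> real) \<Rightarrow> real \<Rightarrow> real \<Rightarrow> (real \<Rightarrow> real) \<Rightarrow> (real \<Rightarrow> real) \<Rightarrow> bool" where
  "dominant_energy_tan \<rho>0 k R x y \<longleftrightarrow>
     (\<forall>r\<in>{0..R}. \<bar>ptan_hat \<rho>0 k (x r) (y r)\<bar> \<le> rho_hat \<rho>0 k (x r) (y r))"

definition dominant_energy ::
  "(real \<Rightarrow> real) \<Rightarrow> real \<Rightarrow> real \<Rightarrow> (real \<Rightarrow> real) \<Rightarrow> (real \<Rightarrow> real) \<Rightarrow> bool" where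
  "dominant_energy \<rho>0 k R x y \<longleftrightarrow>
     dominant_energy_rad \<rho>0 k R x y \<and> dominant_energy_tan \<rho>0 k R x y"

end

theory Submission
  imports Defs
begin

text \<open>Along a solution the chain rule turns the equation for \<open>x'\<close> into the
  Tolman--Oppenheimer--Volkoff equation
  \<open>p_rad' = - (p_rad + \<rho>) (m + r\<^sup>3 p_rad / 2) / (r (r - 2 m)) + 2 (p_tan - p_rad) / r\<close>.
  It implies \<open>x \<le> y\<close>: while \<open>x \<ge> y\<close> the radial pressure decreases and \<open>y\<close> increases,
  but leaving the diagonal into \<open>x > y\<close> with increasing \<open>y\<close> makes \<open>p_rad\<close> increase.
  The identity \<open>p_tan = 3/2 (\<Gamma> - 1) \<rho> - p_rad / 2\<close> explains the threshold \<open>5/3\<close>.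
  For \<open>\<Gamma> > 5/3\<close> the remaining point is \<open>x R > 0\<close>: if \<open>x R = 0\<close>, then \<open>\<rho> = O(p_rad)\<close>
  near \<open>R\<close>, so \<open>p_rad' \<ge> - C p_rad\<close>, and \<open>p_rad\<close> could not vanish at \<open>R\<close>.\<close>

section \<open>Particle density and shear factor\<close>

lemma particle_density_powr:
  assumes "x \<ge> 0" "y \<ge> 0"
  shows "particle_density x y powr p = x powr (p / 2) * y powr p"
  using assms by (simp add: particle_density_def powr_mult powr_half_sqrt[symmetric] powr_powr)

lemma particle_density_pos: "x > 0 \<Longrightarrow> y > 0 \<Longrightarrow> particle_density x y > 0"
  by (simp add: particle_density_def)

text \<open>This is AM-GM for \<open>x\<close>, \<open>y\<close>, \<open>y\<close>, whose geometric
  mean is \<open>particle_density x y powr (2/3)\<close>. In cube roots the defect factors as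
  \<open>(X - Y)\<^sup>2 * (X + 2 * Y)\<close>.\<close>

lemma shear_factor_ge_1:
  assumes "x > 0" "y > 0" "k \<ge> 0"
  shows "shear_factor k x y \<ge> 1"
proof -
  define X Y where "X = x powr (1/3)" and "Y = y powr (1/3)"
  have pos: "X > 0" "Y > 0"
    using assms by (auto simp: X_def Y_def)
  have x: "x = X ^ 3" and y: "y = Y ^ 3"
    using assms by (simp_all add: X_def Y_def powr_power)
  have "particle_density x y powr (2/3) = X * Y\<^sup>2"
    using assms by (simp add: particle_density_powr X_def Y_def powr_power)
  moreover have "x + 2 * y - 3 * (X * Y\<^sup>2) = (X - Y)\<^sup>2 * (X + 2 * Y)"
    unfolding x y by algebra
  ultimately have "x + 2 * y \<ge> 3 * particle_density x y powr (2/3)"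
    using pos by (smt (verit) mult_nonneg_nonneg zero_le_power2)
  then show ?thesis
    using particle_density_pos[OF assms(1,2)] assms(3)
    by (simp add: shear_factor_def pos_le_divide_eq)
qed

section \<open>Radial pressure of a power-law fluid as a sum of monomials\<close>

definition power_law_prad :: "real \<Rightarrow> real \<Rightarrow> real \<Rightarrow> real \<Rightarrow> real \<Rightarrow> real" where
  "power_law_prad a \<Gamma> k x y =
     a * (\<Gamma> - 1) * (1 - 3 * k) * (x powr (\<Gamma>/2) * y powr \<Gamma>)
     + a * k * (\<Gamma> + 1/3) * (x powr (\<Gamma>/2 + 2/3) * y powr (\<Gamma> - 2/3))
     + a * k * (2 * \<Gamma> - 10/3) * (x powr (\<Gamma>/2 - 1/3) * y powr (\<Gamma> + 1/3))"

text \<open>Exponents stay in the unsimplified form \<open>p - 1\<close> produced by differentiating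
  a monomial.\<close>

definition power_law_prad_dx :: "real \<Rightarrow> real \<Rightarrow> real \<Rightarrow> real \<Rightarrow> real \<Rightarrow> real" where
  "power_law_prad_dx a \<Gamma> k x y =
     a * (\<Gamma> - 1) * (1 - 3 * k) * ((\<Gamma>/2) * x powr (\<Gamma>/2 - 1) * y powr \<Gamma>)
     + a * k * (\<Gamma> + 1/3) * ((\<Gamma>/2 + 2/3) * x powr (\<Gamma>/2 + 2/3 - 1) * y powr (\<Gamma> - 2/3))
     + a * k * (2 * \<Gamma> - 10/3) * ((\<Gamma>/2 - 1/3) * x powr (\<Gamma>/2 - 1/3 - 1) * y powr (\<Gamma> + 1/3))"

definition power_law_prad_dy :: "real \<Rightarrow> real \<Rightarrow> real \<Rightarrow> real \<Rightarrow> real \<Rightarrow> real" where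
  "power_law_prad_dy a \<Gamma> k x y =
     a * (\<Gamma> - 1) * (1 - 3 * k) * (\<Gamma> * x powr (\<Gamma>/2) * y powr (\<Gamma> - 1))
     + a * k * (\<Gamma> + 1/3) * ((\<Gamma> - 2/3) * x powr (\<Gamma>/2 + 2/3) * y powr (\<Gamma> - 2/3 - 1))
     + a * k * (2 * \<Gamma> - 10/3) * ((\<Gamma> + 1/3) * x powr (\<Gamma>/2 - 1/3) * y powr (\<Gamma> + 1/3 - 1))"

lemma has_real_derivative_powr_mult_powr:
  fixes x y :: "real \<Rightarrow> real"
  assumes "(x has_real_derivative x') (at r)" "(y has_real_derivative y') (at r)"
    and "x r > 0" "y r > 0"
  shows "((\<lambda>r. x r powr p * y r powr q) has_real_derivative
           (p * x r powr (p - 1) * y r powr q) * x' + (q * x r powr p * y r powr (q - 1)) * y') (at r)"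
proof -
  have "((\<lambda>r. x r powr p) has_real_derivative p * x r powr (p - 1) * x') (at r)"
    "((\<lambda>r. y r powr q) has_real_derivative q * y r powr (q - 1) * y') (at r)"
    using DERIV_fun_powr[OF assms(1,3), of p] DERIV_fun_powr[OF assms(2,4), of q] by auto
  from DERIV_mult[OF this] show ?thesis
    by (rule back_subst[where P = "\<lambda>D. (_ has_real_derivative D) _"]) (simp add: algebra_simps)
qed

lemma continuous_on_powr_mult_powr:
  fixes x y :: "real \<Rightarrow> real"
  assumes x: "continuous_on S x" and y: "continuous_on S y"
    and "\<And>r. r \<in> S \<Longrightarrow> x r \<ge> 0" "\<And>r. r \<in> S \<Longrightarrow> y r > 0" "p > 0"
  shows "continuous_on S (\<lambda>r. x r powr p * y r powr q)"
proof (rule continuous_on_mult)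
  show "continuous_on S (\<lambda>r. x r powr p)"
    by (rule continuous_on_powr'[OF x continuous_on_const]) (use assms in auto)
  show "continuous_on S (\<lambda>r. y r powr q)"
    by (rule continuous_on_powr[OF y continuous_on_const]) (use assms in force)
qed

text \<open>Serves twice: with one argument constant it yields the partial derivatives of
  \<open>prad\<close>, and along a solution the total derivative.\<close>

lemma power_law_prad_chain_rule:
  fixes x y :: "real \<Rightarrow> real"
  assumes "(x has_real_derivative x') (at r)" "(y has_real_derivative y') (at r)"
    and "x r > 0" "y r > 0"
  shows "((\<lambda>r. power_law_prad a \<Gamma> k (x r) (y r)) has_real_derivative
           power_law_prad_dx a \<Gamma> k (x r) (y r) * x' + power_law_prad_dy a \<Gamma> k (x r) (y r) * y') (at r)"
proof -
  \<comment> \<open>Read from right to left, this splits the claimed derivative into one summand per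
    monomial.\<close>
  have regroup: "c1 * (p1 * x' + q1 * y') + c2 * (p2 * x' + q2 * y') + c3 * (p3 * x' + q3 * y')
      = (c1 * p1 + c2 * p2 + c3 * p3) * x' + (c1 * q1 + c2 * q2 + c3 * q3) * y'"
    for c1 c2 c3 p1 p2 p3 q1 q2 q3 :: real
    by (simp add: algebra_simps)
  show ?thesis
    unfolding power_law_prad_def power_law_prad_dx_def power_law_prad_dy_def
      regroup[symmetric]
    by (intro DERIV_add DERIV_cmult has_real_derivative_powr_mult_powr assms)
qed

section \<open>Pointwise constitutive estimates for the power-law fluid\<close>

locale power_law_fluid =
  fixes \<rho>0 :: "real \<Rightarrow> real" and a \<Gamma> k :: real
  assumes k_pos: "k > 0" and Gamma_gt_1: "1 < \<Gamma>" and a_pos: "a > 0"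
    and rho0: "\<And>n. n \<ge> 0 \<Longrightarrow> \<rho>0 n = a * n powr \<Gamma>"
begin

abbreviation "rho \<equiv> rho_hat \<rho>0 k"
abbreviation "prad \<equiv> prad_hat \<rho>0 k"
abbreviation "ptan \<equiv> ptan_hat \<rho>0 k"

definition fluid_rho :: "real \<Rightarrow> real \<Rightarrow> real" where
  "fluid_rho x y = a * particle_density x y powr \<Gamma>"

text \<open>For positive arguments its sign is that of \<open>prad - ptan\<close>, by
  \<open>ptan_minus_prad\<close>.\<close>

definition anisotropy :: "real \<Rightarrow> real \<Rightarrow> real" where
  "anisotropy x y = (x - y) / particle_density x y powr (2/3)"

lemma fluid_rho_pos: "x > 0 \<Longrightarrow> y > 0 \<Longrightarrow> fluid_rho x y > 0"
  using a_pos particle_density_pos[of x y] by (simp add: fluid_rho_def)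

lemma
  assumes "x > 0" "y > 0"
  shows rho_eq: "rho x y = fluid_rho x y * shear_factor k x y"
    and prad_eq: "prad x y = fluid_rho x y * ((\<Gamma> - 1) * shear_factor k x y + 4 * k / 3 * anisotropy x y)"
    and ptan_eq: "ptan x y = fluid_rho x y * ((\<Gamma> - 1) * shear_factor k x y - 2 * k / 3 * anisotropy x y)"
proof -
  have n: "particle_density x y \<ge> 0"
    using particle_density_pos[OF assms] by simp
  show "rho x y = fluid_rho x y * shear_factor k x y"
    using assms by (simp add: rho_hat_def rho0[OF n] fluid_rho_def)
  show "prad x y = fluid_rho x y * ((\<Gamma> - 1) * shear_factor k x y + 4 * k / 3 * anisotropy x y)"
    "ptan x y = fluid_rho x y * ((\<Gamma> - 1) * shear_factor k x y - 2 * k / 3 * anisotropy x y)"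
    using assms
    by (simp_all add: prad_hat_def ptan_hat_def rho0[OF n] fluid_pressure_power_law[OF rho0 n]
        fluid_rho_def anisotropy_def algebra_simps)
qed

text \<open>Both sides are 0 at \<open>x = 0\<close>, since \<open>0 powr p = 0\<close>. Including
  this case makes the radial pressure continuous up to the boundary of the body even if
  \<open>x R = 0\<close>.\<close>

lemma prad_power_law:
  assumes "x \<ge> 0" "y > 0"
  shows "prad x y = power_law_prad a \<Gamma> k x y"
proof (cases "x = 0")
  case True
  then show ?thesis by (simp add: prad_hat_def power_law_prad_def)
next
  case False
  then have x: "x > 0" using assms by simp
  define N where "N = x powr (1/3) * y powr (2/3)"
  have N: "particle_density x y powr (2/3) = N" "N > 0"
    using x assms by (simp_all add: particle_density_powr N_def)
  have D: "fluid_rho x y = a * (x powr (\<Gamma>/2) * y powr \<Gamma>)"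
    using x assms by (simp add: fluid_rho_def particle_density_powr)
  have px: "x powr (\<Gamma>/2) * y powr \<Gamma> * x / N = x powr (\<Gamma>/2 + 2/3) * y powr (\<Gamma> - 2/3)"
  proof -
    have "x powr (\<Gamma>/2) * x powr 1 / x powr (1/3) = x powr (\<Gamma>/2 + 1 - 1/3)"
      by (simp only: powr_add powr_diff)
    then have "x powr (\<Gamma>/2) * x / x powr (1/3) = x powr (\<Gamma>/2 + 2/3)"
      using x by (simp add: add.commute)
    moreover have "y powr \<Gamma> / y powr (2/3) = y powr (\<Gamma> - 2/3)"
      by (simp add: powr_diff)
    moreover have "x powr (\<Gamma>/2) * y powr \<Gamma> * x / N = (x powr (\<Gamma>/2) * x / x powr (1/3)) * (y powr \<Gamma> / y powr (2/3))"
      by (simp add: N_def)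
    ultimately show ?thesis
      by simp
  qed
  have py: "x powr (\<Gamma>/2) * y powr \<Gamma> * y / N = x powr (\<Gamma>/2 - 1/3) * y powr (\<Gamma> + 1/3)"
  proof -
    have "y powr \<Gamma> * y powr 1 / y powr (2/3) = y powr (\<Gamma> + 1 - 2/3)"
      by (simp only: powr_add powr_diff)
    then have "y powr \<Gamma> * y / y powr (2/3) = y powr (\<Gamma> + 1/3)"
      using assms by (simp add: add.commute)
    moreover have "x powr (\<Gamma>/2) / x powr (1/3) = x powr (\<Gamma>/2 - 1/3)"
      by (simp add: powr_diff)
    moreover have "x powr (\<Gamma>/2) * y powr \<Gamma> * y / N = (x powr (\<Gamma>/2) / x powr (1/3)) * (y powr \<Gamma> * y / y powr (2/3))"
      by (simp add: N_def)
    ultimately show ?thesis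
      by simp
  qed
  have "prad x y = a * (\<Gamma> - 1) * (1 - 3 * k) * (x powr (\<Gamma>/2) * y powr \<Gamma>)
     + a * k * (\<Gamma> + 1/3) * (x powr (\<Gamma>/2) * y powr \<Gamma> * x / N)
     + a * k * (2 * \<Gamma> - 10/3) * (x powr (\<Gamma>/2) * y powr \<Gamma> * y / N)"
    unfolding prad_eq[OF x assms(2)] D anisotropy_def shear_factor_def N(1)
    using N(2) by (simp add: field_simps)
  then show ?thesis
    by (simp only: px py power_law_prad_def)
qed

lemma
  assumes "x > 0" "y > 0"
  shows prad_dx_power_law: "prad_hat_dx \<rho>0 k x y = power_law_prad_dx a \<Gamma> k x y"
    and prad_dy_power_law: "prad_hat_dy \<rho>0 k x y = power_law_prad_dy a \<Gamma> k x y"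
proof -
  have "((\<lambda>s. power_law_prad a \<Gamma> k s y) has_real_derivative power_law_prad_dx a \<Gamma> k x y) (at x)"
    using power_law_prad_chain_rule[OF DERIV_ident DERIV_const, of x y] assms by simp
  then have "((\<lambda>s. prad s y) has_real_derivative power_law_prad_dx a \<Gamma> k x y) (at x)"
    by (rule has_field_derivative_transform_within_open[where S = "{0<..}"])
      (use assms in \<open>auto simp: prad_power_law\<close>)
  then show "prad_hat_dx \<rho>0 k x y = power_law_prad_dx a \<Gamma> k x y"
    unfolding prad_hat_dx_def by (rule DERIV_imp_deriv)
  have "((\<lambda>s. power_law_prad a \<Gamma> k x s) has_real_derivative power_law_prad_dy a \<Gamma> k x y) (at y)"
    using power_law_prad_chain_rule[OF DERIV_const DERIV_ident, of x y] assms by simp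
  then have "((\<lambda>s. prad x s) has_real_derivative power_law_prad_dy a \<Gamma> k x y) (at y)"
    by (rule has_field_derivative_transform_within_open[where S = "{0<..}"])
      (use assms in \<open>auto simp: prad_power_law\<close>)
  then show "prad_hat_dy \<rho>0 k x y = power_law_prad_dy a \<Gamma> k x y"
    unfolding prad_hat_dy_def by (rule DERIV_imp_deriv)
qed

text \<open>The anisotropy enters \<open>prad\<close> and \<open>ptan\<close> with weights in ratio
  2 to -1, so it cancels in \<open>ptan + prad / 2\<close>.\<close>

lemma ptan_eq_rho_prad:
  assumes "x > 0" "y > 0"
  shows "ptan x y = 3/2 * (\<Gamma> - 1) * rho x y - prad x y / 2"
  by (simp add: rho_eq prad_eq ptan_eq assms field_simps)

lemma rho_pos: "x > 0 \<Longrightarrow> y > 0 \<Longrightarrow> rho x y > 0"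
  using fluid_rho_pos[of x y] shear_factor_ge_1[of x y k] k_pos by (simp add: rho_eq)

lemma anisotropy_nonpos: "x \<le> y \<Longrightarrow> anisotropy x y \<le> 0"
  and anisotropy_nonneg: "y \<le> x \<Longrightarrow> 0 \<le> anisotropy x y"
  by (auto simp: anisotropy_def divide_le_0_iff)

lemma ptan_minus_prad: "x > 0 \<Longrightarrow> y > 0 \<Longrightarrow> ptan x y - prad x y = - (2 * k * fluid_rho x y * anisotropy x y)"
  by (simp add: prad_eq ptan_eq field_simps)

text \<open>For \<open>x \<le> y\<close> the anisotropy lowers \<open>prad\<close> below
  \<open>(\<Gamma> - 1) * rho\<close> and raises \<open>ptan\<close> above it, so
  \<open>ptan\<close> is nonnegative. The upper bound on \<open>ptan\<close> comes from
  \<open>ptan_eq_rho_prad\<close>: with \<open>prad \<ge> 0\<close> it is at most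
  \<open>3/2 * (\<Gamma> - 1) * rho\<close>, hence at most \<open>rho\<close> when
  \<open>\<Gamma> \<le> 5/3\<close>.\<close>

lemma dominant_energy_pointwise:
  assumes "x > 0" "y > 0" "x \<le> y" "prad x y \<ge> 0" "\<Gamma> \<le> 5/3"
  shows "\<bar>prad x y\<bar> \<le> rho x y" "\<bar>ptan x y\<bar> \<le> rho x y"
proof -
  have "fluid_rho x y * (k * anisotropy x y) \<le> 0"
    using fluid_rho_pos[of x y] anisotropy_nonpos[of x y] k_pos assms by (simp add: mult_nonneg_nonpos)
  moreover have "prad x y = (\<Gamma> - 1) * rho x y + 4/3 * (fluid_rho x y * (k * anisotropy x y))"
    "ptan x y = (\<Gamma> - 1) * rho x y - 2/3 * (fluid_rho x y * (k * anisotropy x y))"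
    by (simp_all add: rho_eq prad_eq ptan_eq assms(1,2) field_simps)
  moreover have "(\<Gamma> - 1) * rho x y \<le> 2/3 * rho x y" "0 \<le> (\<Gamma> - 1) * rho x y"
    using rho_pos[of x y] assms Gamma_gt_1 by (auto intro: mult_right_mono)
  moreover have "ptan x y \<le> 3/2 * (\<Gamma> - 1) * rho x y"
    using ptan_eq_rho_prad[of x y] assms by simp
  moreover have "rho x y > 0"
    using rho_pos assms by blast
  ultimately show "\<bar>prad x y\<bar> \<le> rho x y" "\<bar>ptan x y\<bar> \<le> rho x y"
    using assms(4) by linarith+
qed

text \<open>On the diagonal the shear factor is 1 and the anisotropy 0. Moving to
  \<open>x > y \<ge> h\<close> does not decrease the fluid density or the shear factor, and makes
  the anisotropy positive.\<close>

lemma prad_increases_off_diagonal: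
  assumes "0 < h" "h \<le> y" "y < x"
  shows "prad h h < prad x y"
proof -
  have "fluid_rho h h \<le> fluid_rho x y"
    unfolding fluid_rho_def particle_density_def using assms a_pos Gamma_gt_1
    by (intro mult_left_mono powr_mono2 mult_mono) auto
  moreover have "shear_factor k x y \<ge> 1"
    using assms k_pos by (intro shear_factor_ge_1) auto
  then have "(\<Gamma> - 1) * shear_factor k x y \<ge> \<Gamma> - 1"
    using Gamma_gt_1 by simp
  moreover have "anisotropy x y > 0"
    using assms particle_density_pos[of x y] by (simp add: anisotropy_def)
  then have "4 * k / 3 * anisotropy x y > 0" using k_pos by simp
  ultimately have "\<Gamma> - 1 < (\<Gamma> - 1) * shear_factor k x y + 4 * k / 3 * anisotropy x y"
    by linarith
  with \<open>fluid_rho h h \<le> fluid_rho x y\<close>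
  have "fluid_rho h h * (\<Gamma> - 1)
      < fluid_rho x y * ((\<Gamma> - 1) * shear_factor k x y + 4 * k / 3 * anisotropy x y)"
    using fluid_rho_pos[of h h] assms Gamma_gt_1 by (intro mult_le_less_imp_less) auto
  moreover have "shear_factor k h h = 1"
  proof -
    have "particle_density h h powr (2/3) = h"
      using assms by (simp add: particle_density_powr flip: powr_add)
    then show ?thesis using assms by (simp add: shear_factor_def)
  qed
  ultimately show ?thesis
    using assms by (simp add: prad_eq anisotropy_def[of h h])
qed

text \<open>The hypothesis says that \<open>shear_factor k x y \<ge> 4 k / (\<Gamma> - 5/3)\<close>, multiplied by the power
  of \<open>n\<close> in the denominator so that it remains meaningful, and stable, at \<open>x = 0\<close>.\<close>

lemma rho_le_prad_near_zero:
  assumes "x > 0" "y > 0" "\<Gamma> > 5/3"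
    and "k * (x + 2 * y) + (1 - 3 * k - 4 * k / (\<Gamma> - 5/3)) * (x powr (1/3) * y powr (2/3)) \<ge> 0"
  shows "(\<Gamma> - 5/3) / 2 * rho x y \<le> prad x y"
proof -
  define N where "N = particle_density x y powr (2/3)"
  have N: "N = x powr (1/3) * y powr (2/3)" "N > 0"
    using assms by (simp_all add: N_def particle_density_powr)
  define S where "S = shear_factor k x y"
  have S: "k * (x + 2 * y) = (S - 1 + 3 * k) * N"
    using N(2) by (simp add: S_def shear_factor_def algebra_simps add_divide_distrib flip: N_def)
  have "(S - 4 * k / (\<Gamma> - 5/3)) * N \<ge> 0"
    using assms(4) unfolding S N(1)[symmetric] by (simp add: algebra_simps)
  then have "S \<ge> 4 * k / (\<Gamma> - 5/3)"
    using N(2) by (simp add: zero_le_mult_iff)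
  then have 1: "(\<Gamma> - 5/3) * S \<ge> 4 * k"
    using assms(3) by (simp add: pos_divide_le_eq mult.commute)
  \<comment> \<open>Bounds the negative anisotropy by the shear itself, so that everything is
    expressed through \<open>S\<close>.\<close>
  have "k * (y - x) \<le> k * (x + 2 * y) / 2"
    using assms k_pos by (simp add: field_simps)
  then have "k * (y - x) / N \<le> (S - 1 + 3 * k) / 2"
    using S N(2) by (simp add: divide_simps mult.commute)
  then have 2: "4 * k / 3 * anisotropy x y \<ge> - (2/3 * (S - 1 + 3 * k))"
    using N(2) by (simp add: anisotropy_def flip: N_def) (simp add: field_simps)
  \<comment> \<open>Here \<open>T\<close> is \<open>(\<Gamma> - 5/3) * S\<close> and
    \<open>W\<close> the anisotropy term. The \<open>2/3 * S\<close> cancels against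
    \<open>W\<close>, leaving a loss of at most \<open>2 * k\<close>, which half of \<open>T\<close>
    absorbs; this fixes the constant \<open>4 * k\<close>.\<close>
  have "T / 2 \<le> T + 2/3 * S + W" if "T \<ge> 4 * k" "W \<ge> - (2/3 * (S - 1 + 3 * k))" for T W
    using that by argo
  from this[OF 1 2] have "(\<Gamma> - 5/3) / 2 * S \<le> (\<Gamma> - 1) * S + 4 * k / 3 * anisotropy x y"
    by (simp add: algebra_simps)
  then have "fluid_rho x y * ((\<Gamma> - 5/3) / 2 * S) \<le> fluid_rho x y * ((\<Gamma> - 1) * S + 4 * k / 3 * anisotropy x y)"
    using fluid_rho_pos[of x y] assms by (intro mult_left_mono) auto
  then show ?thesis
    by (simp add: rho_eq prad_eq assms(1,2) S_def mult_ac)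
qed

end

section \<open>Ball solutions: pressure balance and regularity up to the boundary\<close>

locale john_ball = power_law_fluid +
  fixes R M :: real and x y m :: "real \<Rightarrow> real"
  assumes ball: "regular_ball_solution \<rho>0 k R M x y m"
begin

lemma R_pos: "R > 0"
  and continuous_x: "continuous_on {0..R} x"
  and continuous_y: "continuous_on {0..R} y"
  and continuous_m: "continuous_on {0..R} m"
  and centre: "x 0 = y 0"
  and x_pos: "r \<in> {0..<R} \<Longrightarrow> x r > 0"
  and y_pos: "r \<in> {0..<R} \<Longrightarrow> y r > 0"
  and m_pos: "r > 0 \<Longrightarrow> m r > 0"
  and no_horizon: "r > 0 \<Longrightarrow> 2 * m r < r"
  and prad_pos: "r \<in> {0..<R} \<Longrightarrow> prad (x r) (y r) > 0"
  and prad_boundary: "prad (x R) (y R) = 0"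
  and system: "solves_john_system \<rho>0 k R x y m"
  using ball unfolding regular_ball_solution_def C1_upto_boundary_def by auto

lemma x_boundary_nonneg: "x R \<ge> 0"
proof (rule continuous_ge_on_closure[OF continuous_on_subset[OF continuous_x], of "{0..<R}"])
qed (use R_pos x_pos in \<open>auto intro: less_imp_le\<close>)

definition "pr r = prad (x r) (y r)"

text \<open>The radial derivative of the relativistic gravitational potential, in units where
  \<open>m' = r\<^sup>2 \<rho> / 2\<close>.\<close>

definition "gravity r = (m r + r^3 * pr r / 2) / (r * (r - 2 * m r))"

lemma y_deriv:
  assumes "r \<in> {0<..<R}"
  shows "(y has_real_derivative 2 / r * (sqrt (r / (r - 2 * m r) * (x r * y r)) - y r)) (at r)"
  using system assms unfolding solves_john_system_def Let_def by blast

lemma tov: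
  assumes r: "r \<in> {0<..<R}"
  shows "(pr has_real_derivative
           - (pr r + rho (x r) (y r)) * gravity r + 2 / r * (ptan (x r) (y r) - pr r)) (at r)"
proof -
  define px py where "px = prad_hat_dx \<rho>0 k (x r) (y r)" and "py = prad_hat_dy \<rho>0 k (x r) (y r)"
  define E where "E = - (pr r + rho (x r) (y r)) * gravity r + 2 / r * (ptan (x r) (y r) - pr r)"
  have x: "(x has_real_derivative 1 / px * (E - deriv y r * py)) (at r)" and "px \<noteq> 0"
    using system r unfolding solves_john_system_def Let_def px_def py_def E_def gravity_def pr_def
    by blast+
  have y: "(y has_real_derivative deriv y r) (at r)"
    using y_deriv[OF r] DERIV_imp_deriv by metis
  have pos: "x r > 0" "y r > 0" using x_pos y_pos r by auto
  \<comment> \<open>Multiplying the equation for \<open>x'\<close> by the nonzero \<open>px\<close>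
    gives \<open>E - deriv y r * py\<close>, so the \<open>y'\<close> terms of the chain rule
    cancel.\<close>
  have "((\<lambda>r. power_law_prad a \<Gamma> k (x r) (y r)) has_real_derivative E) (at r)"
    using power_law_prad_chain_rule[OF x y pos, of a \<Gamma> k] \<open>px \<noteq> 0\<close>
    unfolding prad_dx_power_law[OF pos, symmetric] prad_dy_power_law[OF pos, symmetric]
    by (simp add: px_def[symmetric] py_def[symmetric] mult.commute)
  then show ?thesis
    unfolding E_def[symmetric]
    by (rule has_field_derivative_transform_within_open[where S = "{0<..<R}"])
      (use r x_pos y_pos in \<open>auto simp: pr_def intro!: prad_power_law[symmetric] less_imp_le\<close>)
qed

text \<open>The factor \<open>r\<^sup>2\<close> absorbs the damping term of the equation for
  \<open>y'\<close>: the derivative of \<open>r\<^sup>2 * y r\<close> is \<open>2 * r\<close> times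
  a square root.\<close>

lemma y_boundary_pos: "y R > 0"
proof -
  have "(R/2)\<^sup>2 * y (R/2) \<le> R\<^sup>2 * y R"
  proof (rule DERIV_nonneg_imp_increasing_open[where f = "\<lambda>r. r\<^sup>2 * y r"])
    show "R/2 \<le> R" using R_pos by simp
    show "continuous_on {R/2..R} (\<lambda>r. r\<^sup>2 * y r)"
      using R_pos by (intro continuous_intros continuous_on_subset[OF continuous_y]) auto
    fix r assume r: "R/2 < r" "r < R"
    let ?s = "sqrt (r / (r - 2 * m r) * (x r * y r))"
    have "?s \<ge> 0"
      using r R_pos no_horizon[of r] x_pos[of r] y_pos[of r] by simp
    moreover have "((\<lambda>r. r\<^sup>2 * y r) has_real_derivative 2 * r * ?s) (at r)"
      using r R_pos by (auto intro!: derivative_eq_intros y_deriv simp: field_simps power2_eq_square)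
    ultimately show "\<exists>d. ((\<lambda>r. r\<^sup>2 * y r) has_real_derivative d) (at r) \<and> 0 \<le> d"
      using r R_pos by (intro exI[of _ "2 * r * ?s"]) auto
  qed
  moreover have "(R/2)\<^sup>2 * y (R/2) > 0"
    using R_pos y_pos[of "R/2"] by simp
  ultimately have "0 < R\<^sup>2 * y R"
    by linarith
  then show ?thesis using R_pos by (simp add: zero_less_mult_iff)
qed

lemma x_nonneg: "r \<in> {0..R} \<Longrightarrow> x r \<ge> 0"
  using x_pos[of r] x_boundary_nonneg by (cases "r = R") auto

lemma y_pos_closed: "r \<in> {0..R} \<Longrightarrow> y r > 0"
  using y_pos[of r] y_boundary_pos by (cases "r = R") auto

lemma continuous_pr: "continuous_on {0..R} pr"
proof -
  have "continuous_on {0..R} (\<lambda>r. power_law_prad a \<Gamma> k (x r) (y r))"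
    unfolding power_law_prad_def
    by (intro continuous_on_add continuous_on_mult_left continuous_on_powr_mult_powr
        continuous_x continuous_y x_nonneg y_pos_closed) (use Gamma_gt_1 in auto)
  then show ?thesis
    by (rule continuous_on_eq) (use x_nonneg y_pos_closed in \<open>auto simp: pr_def prad_power_law\<close>)
qed

lemma gravity_nonneg:
  assumes "r \<in> {0<..R}"
  shows "gravity r \<ge> 0"
proof -
  have "pr r \<ge> 0"
    using assms prad_pos[of r] prad_boundary by (cases "r = R") (auto simp: pr_def)
  then show ?thesis
    using assms m_pos[of r] no_horizon[of r] by (simp add: gravity_def)
qed

section \<open>Comparison of \<open>x\<close> and \<open>y\<close>\<close>

lemma x_le_y_interior:
  assumes r1: "r1 \<in> {0..<R}"
  shows "x r1 \<le> y r1"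
proof (rule ccontr)
  assume neg: "\<not> x r1 \<le> y r1"
  \<comment> \<open>The supremum \<open>r0\<close> of \<open>Z\<close> is the last point before
    \<open>r1\<close> with \<open>x \<le> y\<close>; the centre ensures that \<open>Z\<close> is
    nonempty.\<close>
  define Z where "Z = {r \<in> {0..r1}. x r \<le> y r}"
  have cont: "continuous_on {0..r1} x" "continuous_on {0..r1} y"
    using r1 by (auto intro: continuous_on_subset[OF continuous_x] continuous_on_subset[OF continuous_y])
  have "closed Z"
    unfolding Z_def by (rule continuous_on_closed_Collect_le[OF cont closed_atLeastAtMost])
  moreover have "0 \<in> Z" "bdd_above Z"
    using r1 centre by (auto simp: Z_def intro!: bdd_aboveI[of _ r1])
  ultimately have "Sup Z \<in> Z"
    using closed_contains_Sup by blast
  define r0 where "r0 = Sup Z"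
  have r0: "0 \<le> r0" "r0 \<le> r1" "x r0 \<le> y r0"
    using \<open>Sup Z \<in> Z\<close> by (auto simp: r0_def Z_def)
  with neg have "r0 < r1" by (cases "r0 = r1") auto
  have above: "x r > y r" if "r0 < r" "r \<le> r1" for r
  proof (rule ccontr)
    assume "\<not> x r > y r"
    then have "r \<in> Z" using that r0 by (simp add: Z_def)
    then have "r \<le> r0" unfolding r0_def by (rule cSup_upper[OF _ \<open>bdd_above Z\<close>])
    with that show False by simp
  qed
  have "y r0 \<le> x r0"
  proof (rule continuous_ge_on_closure[of "{r0<..r1}" "\<lambda>r. x r - y r" r0 0, simplified])
    show "continuous_on (closure {r0<..r1}) (\<lambda>r. x r - y r)"
      using \<open>r0 < r1\<close> r0 by (intro continuous_intros continuous_on_subset[OF cont(1)] continuous_on_subset[OF cont(2)]) auto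
  qed (use \<open>r0 < r1\<close> above in \<open>auto intro: less_imp_le\<close>)
  with r0 have diag: "x r0 = y r0" by simp
  have "y r0 \<le> y r1"
  proof (rule DERIV_nonneg_imp_increasing_open[OF \<open>r0 \<le> r1\<close>])
    fix r assume r: "r0 < r" "r < r1"
    then have r': "r \<in> {0<..<R}" using r0 r1 by auto
    have "r / (r - 2 * m r) \<ge> 1"
      using r' no_horizon[of r] m_pos[of r] by simp
    moreover have "y r * y r \<le> x r * y r" "y r > 0"
      using above[of r] r y_pos[of r] r' by auto
    \<comment> \<open>Positive mass and \<open>x > y\<close> both push the square root above
      \<open>y\<close>, so \<open>y\<close> does not decrease on the interval.\<close>
    ultimately have "1 * (y r * y r) \<le> r / (r - 2 * m r) * (x r * y r)"
      by (intro mult_mono) auto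
    then have "y r \<le> sqrt (r / (r - 2 * m r) * (x r * y r))"
      by (intro real_le_rsqrt) (simp add: power2_eq_square)
    then have "0 \<le> 2 / r * (sqrt (r / (r - 2 * m r) * (x r * y r)) - y r)"
      using r' by simp
    then show "\<exists>d. (y has_real_derivative d) (at r) \<and> 0 \<le> d"
      using y_deriv[OF r'] by blast
  qed (use cont(2) r0 in \<open>auto intro: continuous_on_subset\<close>)
  then have "pr r0 < pr r1"
    unfolding pr_def using prad_increases_off_diagonal[of "y r0" "y r1" "x r1"] diag
      above[of r1] \<open>r0 < r1\<close> y_pos[of r0] r0 r1 by simp
  moreover have "pr r1 \<le> pr r0"
  proof (rule DERIV_nonpos_imp_decreasing_open[OF \<open>r0 \<le> r1\<close>])
    fix r assume r: "r0 < r" "r < r1"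
    then have r': "r \<in> {0<..<R}" using r0 r1 by auto
    have pos: "x r > 0" "y r > 0" using x_pos y_pos r' by auto
    \<comment> \<open>Where \<open>x > y\<close>, gravity and anisotropy both contribute nonpositive
      terms to \<open>pr'\<close>.\<close>
    have "(pr r + rho (x r) (y r)) * gravity r \<ge> 0"
      using gravity_nonneg[of r] r' prad_pos[of r] rho_pos[OF pos] by (auto simp: pr_def)
    moreover have "ptan (x r) (y r) - pr r \<le> 0"
      unfolding pr_def ptan_minus_prad[OF pos]
      using k_pos fluid_rho_pos[OF pos] anisotropy_nonneg[of "y r" "x r"] above[of r] r by simp
    then have "2 / r * (ptan (x r) (y r) - pr r) \<le> 0"
      using r' by (intro mult_nonneg_nonpos) auto
    ultimately have "- (pr r + rho (x r) (y r)) * gravity r + 2 / r * (ptan (x r) (y r) - pr r) \<le> 0"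
      unfolding mult_minus_left by linarith
    then show "\<exists>d. (pr has_real_derivative d) (at r) \<and> d \<le> 0"
      using tov[OF r'] by blast
  qed (use r0 r1 in \<open>auto intro: continuous_on_subset[OF continuous_pr]\<close>)
  ultimately show False by simp
qed

lemma x_le_y:
  assumes "r \<in> {0..R}"
  shows "x r \<le> y r"
proof -
  have "0 \<le> y r - x r"
    by (rule continuous_ge_on_closure[of "{0..<R}" "\<lambda>r. y r - x r"])
      (use assms R_pos x_le_y_interior continuous_x continuous_y in \<open>auto intro!: continuous_intros\<close>)
  then show ?thesis by simp
qed

lemma dominant_energy_holds:
  assumes "\<Gamma> \<le> 5/3"
  shows "dominant_energy \<rho>0 k R x y"
proof -
  have "\<bar>prad (x r) (y r)\<bar> \<le> rho (x r) (y r) \<and> \<bar>ptan (x r) (y r)\<bar> \<le> rho (x r) (y r)"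
    if r: "r \<in> {0..R}" for r
  proof (cases "x r = 0")
    \<comment> \<open>Only possible at \<open>r = R\<close>, where the convention makes all three
      constitutive functions 0.\<close>
    case True
    then show ?thesis by (simp add: prad_hat_def ptan_hat_def rho_hat_def)
  next
    case False
    have "prad (x r) (y r) \<ge> 0"
      using r prad_pos[of r] prad_boundary by (cases "r = R") auto
    then show ?thesis
      using dominant_energy_pointwise[of "x r" "y r"] False x_nonneg[OF r] y_pos_closed[OF r]
        x_le_y[OF r] assms by simp
  qed
  then show ?thesis
    by (simp add: dominant_energy_def dominant_energy_rad_def dominant_energy_tan_def)
qed

section \<open>Behaviour at the boundary of the body\<close>

lemma positive_near_boundary:
  assumes "continuous_on {0..R} f" "f R > (0::real)"
  shows "\<exists>\<delta>>0. \<delta> \<le> R \<and> (\<forall>r\<in>{R - \<delta><..R}. f r > 0)"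
proof -
  have "R \<in> {0..R}" using R_pos by simp
  with assms obtain d where d: "d > 0" "\<And>r. r \<in> {0..R} \<Longrightarrow> dist r R < d \<Longrightarrow> dist (f r) (f R) < f R"
    unfolding continuous_on_iff by metis
  have "f r > 0" if r: "r \<in> {R - min d R<..R}" for r
  proof -
    have "r \<in> {0..R}" "dist r R < d"
      using r by (auto simp: dist_real_def)
    then have "\<bar>f r - f R\<bar> < f R"
      using d(2) by (simp add: dist_real_def)
    then show ?thesis by linarith
  qed
  then show ?thesis
    \<comment> \<open>The minimum with \<open>R\<close> keeps the neighbourhood inside the domain of
      continuity.\<close>
    using d(1) R_pos by (intro exI[of _ "min d R"]) auto
qed

text \<open>Needed because \<open>ptan\<close> and \<open>rho\<close> would both be 0 at
  \<open>R\<close> if \<open>x R = 0\<close>. The contradiction is a Gronwall argument: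
  \<open>exp (C * r) * pr r\<close> is nondecreasing near \<open>R\<close>, positive inside and zero
  at \<open>R\<close>.\<close>

lemma x_boundary_pos:
  assumes "\<Gamma> > 5/3"
  shows "x R > 0"
proof (rule ccontr)
  assume "\<not> x R > 0"
  then have xR: "x R = 0" using x_boundary_nonneg by simp
  \<comment> \<open>The expression required nonnegative by \<open>rho_le_prad_near_zero\<close>; for
    \<open>x R = 0\<close> it equals \<open>2 * k * y R\<close> at \<open>R\<close>.\<close>
  define g where
    "g r = k * (x r + 2 * y r)
       + (1 - 3 * k - 4 * k / (\<Gamma> - 5/3)) * (x r powr (1/3) * y r powr (2/3))" for r
  have "continuous_on {0..R} g"
    unfolding g_def
    by (intro continuous_on_add continuous_on_mult_left continuous_on_powr_mult_powr
        continuous_x continuous_y x_nonneg y_pos_closed) auto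
  moreover have "g R > 0"
    using k_pos y_boundary_pos by (simp add: g_def xR)
  ultimately obtain \<delta> where \<delta>: "\<delta> > 0" "\<delta> \<le> R" "\<And>r. r \<in> {R - \<delta><..R} \<Longrightarrow> g r > 0"
    using positive_near_boundary[of g] by blast
  \<comment> \<open>Halving gives a compact interval away from the centre on which \<open>g\<close>
    is positive and \<open>gravity\<close> is continuous, hence bounded.\<close>
  define r0 where "r0 = R - \<delta> / 2"
  have r0: "0 < r0" "r0 < R" "r0 > R - \<delta>" using \<delta> R_pos by (auto simp: r0_def)
  have "r * (r - 2 * m r) \<noteq> 0" if "r \<in> {r0..R}" for r
    using no_horizon[of r] that r0 by simp
  then have "continuous_on {r0..R} gravity"
    unfolding gravity_def using r0
    by (intro continuous_intros ballI continuous_on_subset[OF continuous_pr]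
        continuous_on_subset[OF continuous_m]) auto
  then have "bounded (gravity ` {r0..R})"
    using compact_continuous_image compact_imp_bounded compact_Icc by blast
  then obtain B where B: "\<And>r. r \<in> {r0..R} \<Longrightarrow> gravity r \<le> B"
    unfolding bounded_real by (metis abs_le_D1 imageI)
  \<comment> \<open>The bracket bounds \<open>(pr + rho) / pr\<close> near \<open>R\<close>, and
    \<open>B\<close> bounds \<open>gravity\<close>.\<close>
  define C where "C = (1 + 2 / (\<Gamma> - 5/3)) * B"
  have "exp (C * r0) * pr r0 \<le> exp (C * R) * pr R"
  proof (rule DERIV_nonneg_imp_increasing_open[where f = "\<lambda>r. exp (C * r) * pr r"])
    show "r0 \<le> R" using r0 by simp
    show "continuous_on {r0..R} (\<lambda>r. exp (C * r) * pr r)"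
      using r0 by (intro continuous_intros continuous_on_subset[OF continuous_pr]) auto
    fix r assume r: "r0 < r" "r < R"
    then have r': "r \<in> {0<..<R}" using r0 by auto
    have pos: "x r > 0" "y r > 0" "pr r > 0" using x_pos y_pos prad_pos r' by (auto simp: pr_def)
    define P' where "P' = - (pr r + rho (x r) (y r)) * gravity r + 2 / r * (ptan (x r) (y r) - pr r)"
    have "(\<Gamma> - 5/3) / 2 * rho (x r) (y r) \<le> pr r"
      unfolding pr_def using \<delta>(3)[of r] r r0 pos assms
      by (intro rho_le_prad_near_zero) (auto simp: g_def)
    then have "rho (x r) (y r) \<le> 2 / (\<Gamma> - 5/3) * pr r"
      using assms by (simp add: field_simps)
    then have "pr r + rho (x r) (y r) \<le> (1 + 2 / (\<Gamma> - 5/3)) * pr r"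
      by (simp add: algebra_simps)
    then have "(pr r + rho (x r) (y r)) * gravity r \<le> (1 + 2 / (\<Gamma> - 5/3)) * pr r * B"
      using gravity_nonneg[of r] r r' pos rho_pos[OF pos(1,2)] B[of r] assms by (intro mult_mono) auto
    then have 1: "(pr r + rho (x r) (y r)) * gravity r \<le> C * pr r"
      by (simp add: C_def mult_ac)
    have "fluid_rho (x r) (y r) * anisotropy (x r) (y r) \<le> 0"
      using fluid_rho_pos[OF pos(1,2)] anisotropy_nonpos x_le_y[of r] r' by (intro mult_nonneg_nonpos) auto
    \<comment> \<open>By \<open>x \<le> y\<close> the anisotropy term can only raise
      \<open>pr'\<close>, so a lower bound may drop it.\<close>
    then have "ptan (x r) (y r) - pr r \<ge> 0"
      unfolding pr_def ptan_minus_prad[OF pos(1,2)] using k_pos by (simp add: mult.assoc mult_nonneg_nonpos)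
    then have "2 / r * (ptan (x r) (y r) - pr r) \<ge> 0"
      using r' by simp
    with 1 have "P' + C * pr r \<ge> 0"
      unfolding P'_def mult_minus_left by linarith
    moreover have "((\<lambda>r. exp (C * r) * pr r) has_real_derivative exp (C * r) * (P' + C * pr r)) (at r)"
      unfolding P'_def by (auto intro!: derivative_eq_intros tov[OF r'] simp: algebra_simps)
    ultimately show "\<exists>d. ((\<lambda>r. exp (C * r) * pr r) has_real_derivative d) (at r) \<and> 0 \<le> d"
      by (metis exp_ge_zero mult_nonneg_nonneg)
  qed
  moreover have "pr r0 > 0" "pr R = 0"
    using prad_pos[of r0] prad_boundary r0 by (auto simp: pr_def)
  ultimately show False
    by (simp add: mult_le_0_iff)
qed

text \<open>At \<open>R\<close> the radial pressure vanishes, so \<open>ptan - rho\<close> equals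
  \<open>3/2 * (\<Gamma> - 5/3) * rho\<close>, which is positive; continuity extends this
  inwards.\<close>

lemma tangential_violation:
  assumes "\<Gamma> > 5/3"
  shows "\<exists>\<epsilon>>0. \<forall>r\<in>{R - \<epsilon><..R}. ptan (x r) (y r) > rho (x r) (y r)"
proof -
  have xR: "x R > 0" using x_boundary_pos[OF assms] .
  have pos: "x r > 0" "y r > 0" if "r \<in> {0..R}" for r
    using that xR x_pos[of r] y_pos_closed[of r] by (cases "r = R"; auto)+
  \<comment> \<open>The difference \<open>ptan - rho\<close> without the case distinction at zero,
    so that its continuity is visible.\<close>
  define F where
    "F r = fluid_rho (x r) (y r) * ((\<Gamma> - 2) * shear_factor k (x r) (y r) - 2 * k / 3 * anisotropy (x r) (y r))" for r
  have F: "F r = ptan (x r) (y r) - rho (x r) (y r)" if "r \<in> {0..R}" for r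
    using pos[OF that] by (simp add: F_def rho_eq ptan_eq algebra_simps)
  have "continuous_on {0..R} F"
    unfolding F_def fluid_rho_def anisotropy_def shear_factor_def particle_density_def
    by (intro continuous_intros continuous_on_powr' continuous_x continuous_y)
       (use pos in \<open>force simp: less_imp_le\<close>)+
  moreover have "F R > 0"
  proof -
    have "F R = (3/2 * (\<Gamma> - 1) - 1) * rho (x R) (y R)"
      using F[of R] ptan_eq_rho_prad[OF xR y_boundary_pos] prad_boundary R_pos
      by (simp add: algebra_simps)
    then show ?thesis
      using rho_pos[OF xR y_boundary_pos] assms by simp
  qed
  ultimately obtain \<delta> where "\<delta> > 0" "\<delta> \<le> R" "\<And>r. r \<in> {R - \<delta><..R} \<Longrightarrow> F r > 0"
    using positive_near_boundary[of F] by blast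
  then show ?thesis
    using F by (intro exI[of _ \<delta>]) auto
qed

end

theorem corollary2:
  fixes \<rho>0 :: "real \<Rightarrow> real" and a \<Gamma> k R M :: real and x y m :: "real \<Rightarrow> real"
  assumes "k > 0" and "1 < \<Gamma>" and "\<Gamma> \<le> 2" and "a > 0"
    and "\<And>n. n \<ge> 0 \<Longrightarrow> \<rho>0 n = a * n powr \<Gamma>"
    and "regular_ball_solution \<rho>0 k R M x y m"
  shows "(k < 1 \<and> \<Gamma> \<le> 2 - max k (1/3) \<longrightarrow> dominant_energy \<rho>0 k R x y) \<and>
         (\<Gamma> > 5/3 \<longrightarrow>
            (\<exists>\<epsilon>>0. \<forall>r\<in>{R - \<epsilon><..R}. ptan_hat \<rho>0 k (x r) (y r) > rho_hat \<rho>0 k (x r) (y r)))"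
proof -
  interpret john_ball \<rho>0 a \<Gamma> k R M x y m
    using assms by unfold_locales auto
  show ?thesis
    \<comment> \<open>From \<open>max k (1/3) \<ge> 1/3\<close> the bound in the first claim gives
      \<open>\<Gamma> \<le> 5/3\<close>.\<close>
    using dominant_energy_holds tangential_violation by auto
qed

end
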